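(* If $M_1$ and $M_2$ are matroids then for all integers $k>0$ $$\chi^k_{M_1\oplus M_2}(t_1,\dots,t_k)=\chi^k_{M_1}(t_1,\dots,t_k)\,\chi^k_{M_2}(t_1,\dots,t_k).$$
   Context: A matroid $M=(\mathcal{A},\mathrm{rk})$ is given by a finite ground set $\mathcal{A}$ and its rank function $\mathrm{rk}$; $\mathrm{rk}(M)=\mathrm{rk}(\mathcal{A})$. For $k\ge 1$ let $\mathcal{C}^k_{\mathcal{A}}=\{(A_1,\dots,A_k)\in(2^{\mathcal{A}})^k \mid A_1\subseteq A_2\subseteq\cdots\subseteq A_k\subseteq\mathcal{A}\}$ (inclusions need not be strict). The $k$th chain characteristic polynomial is $\chi_M^k(t_1,\dots,t_k)=\sum_{(A_i)\in\mathcal{C}^k_{\mathcal{A}}}\prod_{i=1}^k(-1)^{|A_i|}t_i^{\mathrm{rk}(M)-\mathrm{rk}(A_i)}$. For $M_1=(\mathcal{A}_1,\mathrm{rk}_1)$ and $M_2=(\mathcal{A}_2,\mathrm{rk}_2)$, the direct sum $M_1\oplus M_2$ is the matroid on $\mathcal{A}_1\sqcup\mathcal{A}_2$ with rank function $A\mapsto \mathrm{rk}_1(A\cap\mathcal{A}_1)+\mathrm{rk}_2(A\cap\mathcal{A}_2)$. *)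

theory Defs
  imports "HOL-Library.Poly_Mapping" "HOL-Library.FuncSet"
begin

locale matroid =
  fixes ground :: "'a set" and rk :: "'a set \<Rightarrow> nat"
  assumes finite_ground: "finite ground"
    and rk_le_card: "A \<subseteq> ground \<Longrightarrow> rk A \<le> card A"
    and rk_mono: "A \<subseteq> B \<Longrightarrow> B \<subseteq> ground \<Longrightarrow> rk A \<le> rk B"
    and rk_submodular: "A \<subseteq> ground \<Longrightarrow> B \<subseteq> ground \<Longrightarrow>
      rk (A \<union> B) + rk (A \<inter> B) \<le> rk A + rk B"

text \<open>Polynomials with integer coefficients in the indeterminates \<open>t\<^sub>0, t\<^sub>1, \<dots>\<close>: the
  outer finitely supported function sends an exponent vector to its coefficient, and the library
  multiplication on this type is the convolution product.\<close>

type_synonym int_mpoly = "(nat \<Rightarrow>\<^sub>0 nat) \<Rightarrow>\<^sub>0 int"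

definition indet :: "nat \<Rightarrow> int_mpoly" where
  "indet i = Poly_Mapping.single (Poly_Mapping.single i 1) 1"

text \<open>A \<open>k\<close>-tuple of sets is a function on \<open>{1..k}\<close>, extended by \<open>undefined\<close> so that distinct
  functions are distinct tuples.\<close>

definition set_chains :: "nat \<Rightarrow> 'a set \<Rightarrow> (nat \<Rightarrow> 'a set) set" where
  "set_chains k E = {A \<in> {1..k} \<rightarrow>\<^sub>E Pow E. \<forall>i\<in>{1..<k}. A i \<subseteq> A (Suc i)}"

text \<open>The exponents use subtraction on \<^typ>\<open>nat\<close>; for a matroid it does not truncate, since
  \<open>rk\<close> is monotone.\<close>

definition chain_char_poly :: "nat \<Rightarrow> 'a set \<Rightarrow> ('a set \<Rightarrow> nat) \<Rightarrow> int_mpoly" where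
  "chain_char_poly k E rk =
    (\<Sum>A\<in>set_chains k E. \<Prod>i=1..k. (- 1) ^ card (A i) * indet i ^ (rk E - rk (A i)))"

text \<open>The ground set of the direct sum is the disjoint union \<open>E1 <+> E2\<close>; the intersection of a
  subset with a summand is taken along the corresponding injection.\<close>

definition direct_sum_rk ::
  "'a set \<Rightarrow> ('a set \<Rightarrow> nat) \<Rightarrow> 'b set \<Rightarrow> ('b set \<Rightarrow> nat) \<Rightarrow> ('a + 'b) set \<Rightarrow> nat" where
  "direct_sum_rk E1 rk1 E2 rk2 A = rk1 (Inl -` A \<inter> E1) + rk2 (Inr -` A \<inter> E2)"

lemma matroid_direct_sum:
  assumes "matroid E1 rk1" and "matroid E2 rk2"
  shows "matroid (E1 <+> E2) (direct_sum_rk E1 rk1 E2 rk2)"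
proof -
  interpret M1: matroid E1 rk1 by fact
  interpret M2: matroid E2 rk2 by fact
  show ?thesis
  proof
    show "finite (E1 <+> E2)"
      by (simp add: M1.finite_ground M2.finite_ground)
  next
    fix A assume A: "A \<subseteq> E1 <+> E2"
    let ?P = "Inl -` A \<inter> E1" and ?Q = "Inr -` A \<inter> E2"
    have fin: "finite ?P" "finite ?Q"
      by (simp_all add: M1.finite_ground M2.finite_ground)
    have "A = ?P <+> ?Q" using A by auto
    then have "card A = card ?P + card ?Q"
      using card_Plus[OF fin] by simp
    then show "direct_sum_rk E1 rk1 E2 rk2 A \<le> card A"
      unfolding direct_sum_rk_def
      using M1.rk_le_card[of ?P] M2.rk_le_card[of ?Q] by simp
  next
    fix A B :: "('a + 'b) set" assume "A \<subseteq> B"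
    then show "direct_sum_rk E1 rk1 E2 rk2 A \<le> direct_sum_rk E1 rk1 E2 rk2 B"
      unfolding direct_sum_rk_def
      by (intro add_mono M1.rk_mono M2.rk_mono) auto
  next
    fix A B :: "('a + 'b) set"
    let ?P = "\<lambda>A. Inl -` A \<inter> E1" and ?Q = "\<lambda>A. Inr -` A \<inter> E2"
    have "?P (A \<union> B) = ?P A \<union> ?P B" "?P (A \<inter> B) = ?P A \<inter> ?P B"
      "?Q (A \<union> B) = ?Q A \<union> ?Q B" "?Q (A \<inter> B) = ?Q A \<inter> ?Q B" by auto
    then show "direct_sum_rk E1 rk1 E2 rk2 (A \<union> B) + direct_sum_rk E1 rk1 E2 rk2 (A \<inter> B)
        \<le> direct_sum_rk E1 rk1 E2 rk2 A + direct_sum_rk E1 rk1 E2 rk2 B"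
      unfolding direct_sum_rk_def
      using M1.rk_submodular[of "?P A" "?P B"] M2.rk_submodular[of "?Q A" "?Q B"] by simp
  qed
qed

end

(* A chain in the disjoint union splits uniquely into a pair of chains, one in each summand, and
   along this bijection cardinalities and coranks add, so each term factors. *)
theory Submission
  imports Defs
begin

text \<open>Each subset of a disjoint union is \<open>B <+> C\<close> for a unique pair, and
  inclusion can be tested on each summand. Hence chains in \<open>E1 <+> E2\<close> correspond to
  pairs of chains: joining (\<open>Plus_set_chains\<close>) and taking preimages under
  \<open>Inl\<close> and \<open>Inr\<close> (\<open>vimage_set_chains\<close>) are mutually inverse.
  Expanding the product of the two polynomials gives a sum over such pairs, and its terms agree with
  those of the direct sum index by index (\<open>chain_char_poly_term_Plus\<close>).\<close>

lemma vimage_Inl_Plus: "Inl -` (A <+> B) = A"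
  by auto

lemma vimage_Inr_Plus: "Inr -` (A <+> B) = B"
  by auto

lemma Plus_vimage_Inl_Inr: "Inl -` A <+> Inr -` A = A"
proof (rule set_eqI)
  show "x \<in> Inl -` A <+> Inr -` A \<longleftrightarrow> x \<in> A" for x
    by (cases x) auto
qed

lemma direct_sum_rk_Plus:
  assumes "B \<subseteq> E1" "C \<subseteq> E2"
  shows "direct_sum_rk E1 rk1 E2 rk2 (B <+> C) = rk1 B + rk2 C"
  using assms by (simp add: direct_sum_rk_def vimage_Inl_Plus vimage_Inr_Plus Int_absorb2)

lemma Plus_set_chains:
  assumes "B \<in> set_chains k E1" "C \<in> set_chains k E2"
  shows "(\<lambda>i\<in>{1..k}. B i <+> C i) \<in> set_chains k (E1 <+> E2)"
proof -
  have "B i <+> C i \<subseteq> E1 <+> E2" if "i \<in> {1..k}" for i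
    using assms that unfolding set_chains_def by (auto dest!: PiE_mem)
  moreover have "B i <+> C i \<subseteq> B (Suc i) <+> C (Suc i)" if "i \<in> {1..<k}" for i
    using assms that unfolding set_chains_def by blast
  ultimately show ?thesis by (auto simp: set_chains_def)
qed

text \<open>Preimages preserve inclusion; leaving \<open>f\<close> arbitrary lets one proof serve
  both \<open>Inl\<close> and \<open>Inr\<close>.\<close>

lemma vimage_set_chains:
  assumes "A \<in> set_chains k E"
  shows "(\<lambda>i\<in>{1..k}. f -` A i) \<in> set_chains k (f -` E)"
proof -
  have "f -` A i \<subseteq> f -` E" if "i \<in> {1..k}" for i
    using assms that unfolding set_chains_def by (auto dest!: PiE_mem)
  moreover have "f -` A i \<subseteq> f -` A (Suc i)" if "i \<in> {1..<k}" for i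
    using assms that unfolding set_chains_def by blast
  ultimately show ?thesis by (auto simp: set_chains_def)
qed

text \<open>Chains are \<open>undefined\<close> outside \<open>{1..k}\<close>, so only the indices
  in that range have to be compared.\<close>

lemma set_chains_eqI:
  assumes "A \<in> set_chains k E" "B \<in> set_chains k F" "\<And>i. i \<in> {1..k} \<Longrightarrow> A i = B i"
  shows "A = B"
  using assms by (intro extensionalityI[of A "{1..k}" B]) (auto simp: set_chains_def PiE_iff)

text \<open>Cardinalities and coranks both add over the summands, so the sign and the power of
  \<open>x\<close> each factor. Finiteness gives the first; for the second, monotonicity keeps the
  subtractions on \<open>nat\<close> from truncating.\<close>

lemma chain_char_poly_term_Plus:
  assumes M1: "matroid E1 rk1" and M2: "matroid E2 rk2"
    and "B \<subseteq> E1" "C \<subseteq> E2"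
  shows "(- 1) ^ card (B <+> C) * (x :: 'c :: comm_ring_1) ^
      (direct_sum_rk E1 rk1 E2 rk2 (E1 <+> E2) - direct_sum_rk E1 rk1 E2 rk2 (B <+> C))
    = (- 1) ^ card B * x ^ (rk1 E1 - rk1 B) * ((- 1) ^ card C * x ^ (rk2 E2 - rk2 C))"
proof -
  have fin: "finite B" "finite C"
    using assms finite_subset matroid.finite_ground by metis+
  have "rk1 B \<le> rk1 E1" "rk2 C \<le> rk2 E2"
    using assms by (auto intro: matroid.rk_mono)
  then have "rk1 E1 + rk2 E2 - (rk1 B + rk2 C) = (rk1 E1 - rk1 B) + (rk2 E2 - rk2 C)"
    by simp
  with assms fin show ?thesis
    by (simp add: direct_sum_rk_Plus card_Plus power_add)
qed

theorem corollary1p6: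
  fixes E1 :: "'a set" and rk1 :: "'a set \<Rightarrow> nat"
    and E2 :: "'b set" and rk2 :: "'b set \<Rightarrow> nat"
    and k :: nat
  assumes "matroid E1 rk1" and "matroid E2 rk2" and "k > 0"
  shows "chain_char_poly k (E1 <+> E2) (direct_sum_rk E1 rk1 E2 rk2)
    = chain_char_poly k E1 rk1 * chain_char_poly k E2 rk2"
proof -
  let ?join = "\<lambda>(B, C). \<lambda>i\<in>{1..k}. B i <+> C i"
  let ?split = "\<lambda>A. (\<lambda>i\<in>{1..k}. Inl -` A i, \<lambda>i\<in>{1..k}. Inr -` A i)"
  let ?term = "\<lambda>E rk A. \<Prod>i=1..k. (- 1) ^ card (A i) * indet i ^ (rk E - rk (A i))"
  let ?chains = "set_chains k E1 \<times> set_chains k E2"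
  have join: "?join p \<in> set_chains k (E1 <+> E2)" if "p \<in> ?chains" for p
    using that Plus_set_chains by auto
  have split: "?split A \<in> ?chains" if "A \<in> set_chains k (E1 <+> E2)" for A
    using vimage_set_chains[OF that, of Inl] vimage_set_chains[OF that, of Inr]
    by (simp add: vimage_Inl_Plus vimage_Inr_Plus)
  have "chain_char_poly k E1 rk1 * chain_char_poly k E2 rk2
      = (\<Sum>(B, C)\<in>?chains. ?term E1 rk1 B * ?term E2 rk2 C)"
    unfolding chain_char_poly_def by (simp add: sum_product sum.cartesian_product)
  also have "\<dots> = (\<Sum>A\<in>set_chains k (E1 <+> E2).
      ?term (E1 <+> E2) (direct_sum_rk E1 rk1 E2 rk2) A)"
  proof (rule sum.reindex_bij_witness[where i = ?split and j = ?join])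
    fix p assume p: "p \<in> ?chains"
    then obtain B C where BC: "p = (B, C)" "B \<in> set_chains k E1" "C \<in> set_chains k E2"
      by auto
    show "?join p \<in> set_chains k (E1 <+> E2)" using p by (rule join)
    \<comment> \<open>Knowing that both components are again chains reduces the round trip to a
      comparison on \<open>{1..k}\<close>, where the restrictions unfold.\<close>
    from split[OF this] have "fst (?split (?join p)) = B" "snd (?split (?join p)) = C"
      by (auto intro: set_chains_eqI[OF _ BC(2)] set_chains_eqI[OF _ BC(3)]
          simp: BC(1) vimage_Inl_Plus vimage_Inr_Plus)
    then show "?split (?join p) = p" by (simp add: BC(1))
    have "B i \<subseteq> E1" "C i \<subseteq> E2" if "i \<in> {1..k}" for i
      using BC that unfolding set_chains_def by (auto dest!: PiE_mem)
    then show "?term (E1 <+> E2) (direct_sum_rk E1 rk1 E2 rk2) (?join p)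
        = (case p of (B, C) \<Rightarrow> ?term E1 rk1 B * ?term E2 rk2 C)"
      \<comment> \<open>Merging the two products over \<open>i\<close> into one leaves an identity
        between single factors.\<close>
      unfolding BC(1) prod.case prod.distrib[symmetric]
      by (intro prod.cong refl) (simp add: chain_char_poly_term_Plus[OF assms(1,2)])
  next
    fix A assume A: "A \<in> set_chains k (E1 <+> E2)"
    show "?split A \<in> ?chains" using A by (rule split)
    from join[OF this] A show "?join (?split A) = A"
      by (rule set_chains_eqI) (simp add: Plus_vimage_Inl_Inr)
  qed
  finally show ?thesis unfolding chain_char_poly_def by simp
qed

end
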